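(* Let $k\ge1$ be an integer and $\theta>0$. Then $$\sum_{a_1\ge\dots\ge a_k\ge1}\frac{|a|!\,\theta^{|a|}\prod_{1\le i<j\le k}\big((j-i)\theta+a_i-a_j\big)}{\prod_{i=1}^k(a_i-a_{i+1})!\cdot\prod_{1\le i<j\le k+1}\big((j-i)\theta+a_i-a_{j-1}\big)_{a_{j-1}-a_{j+1}+1}}=1,$$ where the sum runs over integers $a_1\ge\dots\ge a_k\ge1$, one sets $a_{k+1}=1$ and $a_{k+2}=0$, and $|a|=a_1+\dots+a_k$.
   Context: $(x)_n=x(x+1)\cdots(x+n-1)$ denotes the Pochhammer symbol, $(x)_0=1$. *)

theory Defs
  imports "HOL-Analysis.Analysis"
begin

definition decreasing_tuples :: "nat \<Rightarrow> (nat \<Rightarrow> nat) set" where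
  "decreasing_tuples k =
     {a \<in> {1..k} \<rightarrow>\<^sub>E {1..}. \<forall>i\<in>{1..k}. \<forall>j\<in>{1..k}. i \<le> j \<longrightarrow> a j \<le> a i}"

(* The convention a_{k+1} = 1, a_{k+2} = 0. Only the indices 1, ..., k + 2 are ever used. *)
definition extend_tuple :: "nat \<Rightarrow> (nat \<Rightarrow> nat) \<Rightarrow> nat \<Rightarrow> nat" where
  "extend_tuple k a i = (if i \<le> k then a i else if i = k + 1 then 1 else 0)"

(* For a in decreasing_tuples k the extended tuple is decreasing on {1..k+2}, so the two natural
   number subtractions below (in the factorial and in the pochhammer length) never truncate. *)
definition tuple_summand :: "nat \<Rightarrow> real \<Rightarrow> (nat \<Rightarrow> nat) \<Rightarrow> real" where
  "tuple_summand k \<theta> a =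
     (let b = extend_tuple k a; s = (\<Sum>i=1..k. a i) in
        (fact s * \<theta> ^ s *
           (\<Prod>i=1..k. \<Prod>j=i+1..k. (real j - real i) * \<theta> + real (b i) - real (b j)))
      / ((\<Prod>i=1..k. fact (b i - b (i + 1))) *
           (\<Prod>i=1..k. \<Prod>j=i+1..k+1.
              pochhammer ((real j - real i) * \<theta> + real (b i) - real (b (j - 1)))
                         (b (j - 1) - b (j + 1) + 1))))"

end

theory Submission
  imports Defs
begin

text \<open>
  The summand at $a$ is the probability that the Jack--Plancherel growth process opens its row
  $k+1$ by adding a box to the shape $a$. With $x_i = a_i + (k-i)\theta$, it is the product of the
  Jack--Plancherel weight of $a$ and the transition probability
  $\prod_i x_i/(x_i+\theta)$ to a new row. Two partial fraction identities say that the up and the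
  down transition probabilities sum to 1, so the mass carried at time $n$ by the shapes with at most
  $k$ rows drops from $n$ to $n+1$ by the sum of the summands with $|a| = n$, and the series
  telescopes. The mass tends to 0 by induction on $k$: as soon as $a_k \ge 1$, the
  probability of a new row is at least $(1+\theta)^{-k}$, and the shapes with $a_k = 0$ have at
  most $k-1$ rows.
\<close>

section \<open>Partial fractions of a shifted product\<close>

text \<open>For distinct points, \<open>- t\<close> times this is the residue at w = z i of the
  product of (w - z j - t) / (w - z j) over all j in I.\<close>

definition deleted_ratio :: "('i \<Rightarrow> real) \<Rightarrow> real \<Rightarrow> 'i set \<Rightarrow> 'i \<Rightarrow> real" where
  "deleted_ratio z t I i = (\<Prod>j\<in>I - {i}. (z i - z j - t) / (z i - z j))"

lemma deleted_ratio_insert_old: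
  assumes "finite I" "m \<notin> I" "i \<in> I" "z m \<noteq> z i"
  shows "deleted_ratio z t (insert m I) i = deleted_ratio z t I i * (1 + t / (z m - z i))"
proof -
  have "insert m I - {i} = insert m (I - {i})" using assms by auto
  moreover have "(z i - z m - t) / (z i - z m) = 1 + t / (z m - z i)"
    using assms by (simp add: field_simps)
  ultimately show ?thesis using assms
    by (simp add: deleted_ratio_def mult.commute)
qed

lemma deleted_ratio_insert_new:
  assumes "m \<notin> I"
  shows "deleted_ratio z t (insert m I) m = (\<Prod>j\<in>I. (z m - z j - t) / (z m - z j))"
  using assms by (simp add: deleted_ratio_def)

text \<open>The induction step only needs the case $w = z_m$ of the hypothesis, which evaluates the new
  coefficient, besides $w$ itself.\<close>

lemma prod_shift_partial_fractions:
  assumes "finite I" "inj_on z I" "w \<notin> z ` I"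
  shows "(\<Prod>j\<in>I. (w - z j - t) / (w - z j)) = 1 - (\<Sum>i\<in>I. t / (w - z i) * deleted_ratio z t I i)"
  using assms
proof (induction I arbitrary: w rule: finite_induct)
  case empty
  then show ?case by simp
next
  case (insert m I)
  let ?c = "deleted_ratio z t I"
  have inj: "inj_on z I" and zm: "z m \<notin> z ` I" and w: "w \<notin> z ` I" "w \<noteq> z m"
    using insert by auto
  have new: "deleted_ratio z t (insert m I) m = 1 - (\<Sum>i\<in>I. t / (z m - z i) * ?c i)"
    using insert.IH[OF inj zm] insert.hyps by (simp add: deleted_ratio_insert_new)
  \<comment> \<open>Partial fractions of 1 / ((w - z i) (z m - z i)) in z i leave only terms whose
    sums occur in the hypothesis at w and at z m.\<close>
  have split: "t / (w - z i) * deleted_ratio z t (insert m I) i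
      = t / (w - z i) * ?c i + t / (w - z m) * (t / (z m - z i) * ?c i)
        - t / (w - z m) * (t / (w - z i) * ?c i)" if "i \<in> I" for i
  proof -
    have ne: "w - z m \<noteq> 0" "w - z i \<noteq> 0" "z m - z i \<noteq> 0" using that zm w by auto
    have "1 / (w - z i) * (1 / (z m - z i))
        = 1 / (w - z m) * (1 / (z m - z i)) - 1 / (w - z m) * (1 / (w - z i))"
      using ne by (simp add: divide_simps)
    then have "t * t * ?c i * (1 / (w - z i) * (1 / (z m - z i)))
        = t * t * ?c i * (1 / (w - z m) * (1 / (z m - z i)) - 1 / (w - z m) * (1 / (w - z i)))"
      by simp
    moreover have "deleted_ratio z t (insert m I) i = ?c i * (1 + t / (z m - z i))"
      using that insert.hyps ne by (intro deleted_ratio_insert_old) auto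
    ultimately show ?thesis by (simp add: algebra_simps)
  qed
  have "(\<Sum>i\<in>I. t / (w - z i) * deleted_ratio z t (insert m I) i)
      = (\<Sum>i\<in>I. t / (w - z i) * ?c i + t / (w - z m) * (t / (z m - z i) * ?c i)
        - t / (w - z m) * (t / (w - z i) * ?c i))"
    by (rule sum.cong[OF refl split])
  then have "(\<Sum>i\<in>insert m I. t / (w - z i) * deleted_ratio z t (insert m I) i)
      = t / (w - z m) * (1 - (\<Sum>i\<in>I. t / (z m - z i) * ?c i))
        + ((\<Sum>i\<in>I. t / (w - z i) * ?c i) + t / (w - z m) * (\<Sum>i\<in>I. t / (z m - z i) * ?c i)
        - t / (w - z m) * (\<Sum>i\<in>I. t / (w - z i) * ?c i))"
    using insert.hyps
    by (simp only: sum.insert new sum.distrib sum_subtractf sum_distrib_left simp_thms)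
  \<comment> \<open>The sums taken at z m cancel, so the new point contributes a single
    factor.\<close>
  also have "\<dots> = 1 - (1 - t / (w - z m)) * (1 - (\<Sum>i\<in>I. t / (w - z i) * ?c i))"
    by (simp add: algebra_simps)
  also have "1 - t / (w - z m) = (w - z m - t) / (w - z m)"
    using w by (simp add: field_simps)
  finally show ?case
    using insert.IH[OF inj w(1)] insert.hyps by simp
qed

text \<open>Comparing coefficients of 1/w and 1/w^2 at infinity in
  \<open>prod_shift_partial_fractions\<close> suggests both identities. The proof is a joint
  induction: the expansion at w = z m gives the coefficient of the new point, which absorbs the
  changes in the old ones, and the second identity uses the first.\<close>

lemma sum_deleted_ratio:
  assumes "finite I" "inj_on z I"
  shows "(\<Sum>i\<in>I. deleted_ratio z t I i) = real (card I)"
    and "(\<Sum>i\<in>I. z i * deleted_ratio z t I i)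
           = (\<Sum>i\<in>I. z i) - t * (real (card I) * (real (card I) - 1) / 2)"
proof -
  have "(\<Sum>i\<in>I. deleted_ratio z t I i) = real (card I) \<and>
    (\<Sum>i\<in>I. z i * deleted_ratio z t I i)
           = (\<Sum>i\<in>I. z i) - t * (real (card I) * (real (card I) - 1) / 2)"
    using assms
  proof (induction I rule: finite_induct)
    case empty
    then show ?case by simp
  next
    case (insert m I)
    let ?c = "deleted_ratio z t I" and ?c' = "deleted_ratio z t (insert m I)"
    have inj: "inj_on z I" and zm: "z m \<notin> z ` I" using insert by auto
    have IH: "(\<Sum>i\<in>I. ?c i) = real (card I)"
      "(\<Sum>i\<in>I. z i * ?c i) = (\<Sum>i\<in>I. z i) - t * (real (card I) * (real (card I) - 1) / 2)"
      using insert.IH[OF inj] by auto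
    have new: "?c' m = 1 - (\<Sum>i\<in>I. t / (z m - z i) * ?c i)"
      using prod_shift_partial_fractions[OF insert.hyps(1) inj zm] insert.hyps
      by (simp add: deleted_ratio_insert_new)
    have old: "?c' i = ?c i + t / (z m - z i) * ?c i" if "i \<in> I" for i
      using that zm insert.hyps by (subst deleted_ratio_insert_old) (auto simp: algebra_simps)
    \<comment> \<open>Writing z i = z m - (z m - z i) splits the increment into a multiple of z m,
      which the new coefficient cancels, and \<open>- t * ?c i\<close>, which the first identity
      sums to - t times the cardinality of I.\<close>
    have old': "z i * ?c' i = z i * ?c i + z m * (t / (z m - z i) * ?c i) - t * ?c i"
      if "i \<in> I" for i
    proof -
      have "z m - z i \<noteq> 0" using zm that by auto
      then have "z i * (t / (z m - z i)) = z m * (t / (z m - z i)) - t"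
        by (simp add: field_simps)
      then have "z i * (t / (z m - z i)) * ?c i = (z m * (t / (z m - z i)) - t) * ?c i" by simp
      then show ?thesis unfolding old[OF that] by (simp add: algebra_simps)
    qed
    have "(\<Sum>i\<in>I. ?c' i) = (\<Sum>i\<in>I. ?c i + t / (z m - z i) * ?c i)"
      by (rule sum.cong[OF refl old])
    then have "(\<Sum>i\<in>insert m I. ?c' i) = real (card (insert m I))"
      using insert.hyps by (simp add: new sum.distrib IH)
    moreover have "(\<Sum>i\<in>I. z i * ?c' i)
        = (\<Sum>i\<in>I. z i * ?c i + z m * (t / (z m - z i) * ?c i) - t * ?c i)"
      by (rule sum.cong[OF refl old'])
    then have "(\<Sum>i\<in>insert m I. z i * ?c' i) = z m + (\<Sum>i\<in>I. z i * ?c i) - t * (\<Sum>i\<in>I. ?c i)"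
      using insert.hyps
      by (simp only: sum.insert new sum.distrib sum_subtractf right_diff_distrib simp_thms
          flip: sum_distrib_left)
    then have "(\<Sum>i\<in>insert m I. z i * ?c' i) = (\<Sum>i\<in>insert m I. z i)
        - t * (real (card (insert m I)) * (real (card (insert m I)) - 1) / 2)"
      using insert.hyps by (simp add: IH field_simps)
    ultimately show ?case by blast
  qed
  then show "(\<Sum>i\<in>I. deleted_ratio z t I i) = real (card I)"
    and "(\<Sum>i\<in>I. z i * deleted_ratio z t I i)
           = (\<Sum>i\<in>I. z i) - t * (real (card I) * (real (card I) - 1) / 2)"
    by auto
qed

section \<open>Partitions with at most k rows, their weights and the growth process\<close>

text \<open>Empty rows are allowed and entries outside \<open>{1..k}\<close> are 0, so these sets
  are nested in k and a shape is the same function for every k that accommodates it.\<close>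

definition bounded_partitions :: "nat \<Rightarrow> nat \<Rightarrow> (nat \<Rightarrow> nat) set" where
  "bounded_partitions k n =
     {a. (\<forall>i. i \<notin> {1..k} \<longrightarrow> a i = 0) \<and>
         (\<forall>i\<in>{1..k}. \<forall>j\<in>{1..k}. i \<le> j \<longrightarrow> a j \<le> a i) \<and> (\<Sum>i=1..k. a i) = n}"

text \<open>The multiples of \<theta> separate equal rows, and the last coordinate is
  \<open>a k\<close> itself: an empty row k sits at 0, and an empty row k + 1 would sit at -
  \<theta>.\<close>

definition row_coord :: "nat \<Rightarrow> real \<Rightarrow> (nat \<Rightarrow> nat) \<Rightarrow> nat \<Rightarrow> real" where
  "row_coord k \<theta> a i = real (a i) + (real k - real i) * \<theta>"

text \<open>For \<theta> = 1 and d > 0 this is d^2, and \<open>row_weight\<close> is 1 / (x!)^2 at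
  natural x; \<open>jack_plancherel\<close> then becomes the classical Plancherel weight, (number of
  standard tableaux)^2 / n!.\<close>

definition pair_weight :: "real \<Rightarrow> real \<Rightarrow> real" where
  "pair_weight \<theta> d = d * Gamma (d + \<theta>) / Gamma (d - \<theta> + 1)"

definition row_weight :: "real \<Rightarrow> real \<Rightarrow> real" where
  "row_weight \<theta> x = Gamma \<theta> / (Gamma (x + 1) * Gamma (x + \<theta>))"

text \<open>This is $|a|!\,\theta^{|a|}/(H H')$ for the two Jack hook products
  $H = \prod (\mathrm{arm} + \theta\,\mathrm{leg} + 1)$ and
  $H' = \prod (\mathrm{arm} + \theta\,\mathrm{leg} + \theta)$, written with Gamma functions so
  that adding a box is one application of the functional equation per factor.\<close>

definition jack_plancherel :: "nat \<Rightarrow> real \<Rightarrow> (nat \<Rightarrow> nat) \<Rightarrow> real" where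
  "jack_plancherel k \<theta> a =
     (let s = (\<Sum>i=1..k. a i); x = row_coord k \<theta> a in
      fact s * \<theta> ^ s * (\<Prod>i=1..k. row_weight \<theta> (x i)) *
        (\<Prod>i=1..k. \<Prod>j=i+1..k. pair_weight \<theta> (x i - x j)))"

definition new_row_prob :: "nat \<Rightarrow> real \<Rightarrow> (nat \<Rightarrow> nat) \<Rightarrow> real" where
  "new_row_prob k \<theta> a = (\<Prod>i=1..k. row_coord k \<theta> a i / (row_coord k \<theta> a i + \<theta>))"

text \<open>Probability that the process adds its next box in row $i$; it vanishes by itself when the
  result is not a partition. Likewise \<open>down_prob\<close> is the conditional probability that the last
  added box is the one in row $i$.\<close>

definition up_prob :: "nat \<Rightarrow> real \<Rightarrow> (nat \<Rightarrow> nat) \<Rightarrow> nat \<Rightarrow> real" where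
  "up_prob k \<theta> a i =
     \<theta> / (row_coord k \<theta> a i + \<theta>) * deleted_ratio (row_coord k \<theta> a) (- \<theta>) {1..k} i"

definition down_prob :: "nat \<Rightarrow> real \<Rightarrow> (nat \<Rightarrow> nat) \<Rightarrow> nat \<Rightarrow> real" where
  "down_prob k \<theta> a i =
     row_coord k \<theta> a i * deleted_ratio (row_coord k \<theta> a) \<theta> {1..k} i / real (\<Sum>i=1..k. a i)"

lemma finite_bounded_partitions: "finite (bounded_partitions k n)"
proof (rule finite_subset)
  show "bounded_partitions k n \<subseteq> {a. \<forall>i. (i \<in> {1..k} \<longrightarrow> a i \<in> {..n}) \<and> (i \<notin> {1..k} \<longrightarrow> a i = 0)}"
  proof
    fix a assume a: "a \<in> bounded_partitions k n"
    have "a i \<le> (\<Sum>i=1..k. a i)" if "i \<in> {1..k}" for i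
      by (rule member_le_sum) (use that in auto)
    then show "a \<in> {a. \<forall>i. (i \<in> {1..k} \<longrightarrow> a i \<in> {..n}) \<and> (i \<notin> {1..k} \<longrightarrow> a i = 0)}"
      using a by (simp add: bounded_partitions_def)
  qed
  show "finite {a. \<forall>i. (i \<in> {1..k} \<longrightarrow> a i \<in> {..n}) \<and> (i \<notin> {1..k} \<longrightarrow> a i = (0::nat))}"
    by (rule finite_set_of_finite_funs) auto
qed

lemma row_coord_diff:
  "row_coord k \<theta> a i - row_coord k \<theta> a j = (real j - real i) * \<theta> + real (a i) - real (a j)"
  by (simp add: row_coord_def algebra_simps)

text \<open>The gap \<theta> makes the coordinates distinct and keeps
  \<open>d - \<theta> + 1\<close>, the Gamma argument in the denominator of
  \<open>pair_weight\<close>, positive.\<close>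

lemma row_coord_diff_ge:
  assumes "a \<in> bounded_partitions k n" "\<theta> > 0" "i \<in> {1..k}" "j \<in> {1..k}" "i < j"
  shows "row_coord k \<theta> a i - row_coord k \<theta> a j \<ge> \<theta>"
proof -
  have "a j \<le> a i" using assms by (auto simp: bounded_partitions_def)
  moreover have "(real j - real i) * \<theta> \<ge> 1 * \<theta>"
    using assms by (intro mult_right_mono) auto
  ultimately show ?thesis unfolding row_coord_diff by simp
qed

lemma row_coord_nonneg:
  assumes "\<theta> > 0" "i \<in> {1..k}"
  shows "row_coord k \<theta> a i \<ge> 0"
  using assms by (simp add: row_coord_def)

lemma inj_on_row_coord:
  assumes "a \<in> bounded_partitions k n" "\<theta> > 0"
  shows "inj_on (row_coord k \<theta> a) {1..k}"
proof (rule inj_onI)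
  fix i j assume "i \<in> {1..k}" "j \<in> {1..k}" "row_coord k \<theta> a i = row_coord k \<theta> a j"
  then show "i = j"
    using row_coord_diff_ge[OF assms, of i j] row_coord_diff_ge[OF assms, of j i] assms(2)
    by (cases i j rule: linorder_cases) auto
qed

section \<open>Sums of the up and the down transition probabilities\<close>

text \<open>Evaluate the partial fractions with shift t = - \<theta> at w = - \<theta>, the
  coordinate of the empty row k + 1. Nonnegative coordinates keep this point off the poles, and the
  product there is \<open>new_row_prob\<close>.\<close>

lemma sum_up_prob:
  assumes "a \<in> bounded_partitions k n" "\<theta> > 0"
  shows "(\<Sum>i=1..k. up_prob k \<theta> a i) = 1 - new_row_prob k \<theta> a"
proof -
  let ?x = "row_coord k \<theta> a"
  have nn: "?x i \<ge> 0" if "i \<in> {1..k}" for i using row_coord_nonneg that assms by auto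
  have "- \<theta> \<notin> ?x ` {1..k}" using nn assms by force
  from prod_shift_partial_fractions[OF _ inj_on_row_coord[OF assms] this, of "- \<theta>"]
  have "(\<Prod>j=1..k. (- \<theta> - ?x j - (- \<theta>)) / (- \<theta> - ?x j))
      = 1 - (\<Sum>i=1..k. - \<theta> / (- \<theta> - ?x i) * deleted_ratio ?x (- \<theta>) {1..k} i)" by simp
  moreover have "(\<Prod>j=1..k. (- \<theta> - ?x j - (- \<theta>)) / (- \<theta> - ?x j)) = new_row_prob k \<theta> a"
    unfolding new_row_prob_def
  proof (rule prod.cong[OF refl])
    fix j assume "j \<in> {1..k}"
    with nn[of j] assms show "(- \<theta> - ?x j - (- \<theta>)) / (- \<theta> - ?x j) = ?x j / (?x j + \<theta>)"
      by (simp add: divide_simps) (simp add: algebra_simps)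
  qed
  moreover have "(\<Sum>i=1..k. - \<theta> / (- \<theta> - ?x i) * deleted_ratio ?x (- \<theta>) {1..k} i)
      = (\<Sum>i=1..k. up_prob k \<theta> a i)"
    unfolding up_prob_def
  proof (rule sum.cong[OF refl])
    fix j assume "j \<in> {1..k}"
    with nn[of j] assms have "- \<theta> / (- \<theta> - ?x j) = \<theta> / (?x j + \<theta>)"
      by (simp add: divide_simps) (simp add: algebra_simps)
    then show "- \<theta> / (- \<theta> - ?x j) * deleted_ratio ?x (- \<theta>) {1..k} j
        = \<theta> / (?x j + \<theta>) * deleted_ratio ?x (- \<theta>) {1..k} j" by simp
  qed
  ultimately show ?thesis by simp
qed

text \<open>Take t = \<theta> in the second identity of \<open>sum_deleted_ratio\<close>: its
  correction \<theta> k (k - 1) / 2 is exactly the total shift in the coordinates, so n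
  remains.\<close>

lemma sum_down_prob:
  assumes "a \<in> bounded_partitions k n" "\<theta> > 0" "n > 0"
  shows "(\<Sum>i=1..k. down_prob k \<theta> a i) = 1"
proof -
  let ?x = "row_coord k \<theta> a"
  have s: "(\<Sum>i=1..k. a i) = n" using assms by (simp add: bounded_partitions_def)
  have "(\<Sum>i=1..k. real i) = real k * (real k + 1) / 2"
    by (induction k) (simp_all add: field_simps)
  then have "(\<Sum>i=1..k. (real k - real i) * \<theta>) = \<theta> * (real k * (real k - 1) / 2)"
    by (simp add: sum_subtractf flip: sum_distrib_right) (simp add: field_simps)
  then have "(\<Sum>i=1..k. ?x i) = real n + \<theta> * (real k * (real k - 1) / 2)"
    unfolding row_coord_def sum.distrib s[symmetric] by simp
  then have "(\<Sum>i=1..k. ?x i * deleted_ratio ?x \<theta> {1..k} i) = real n"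
    using sum_deleted_ratio(2)[OF _ inj_on_row_coord[OF assms(1,2)], of \<theta>] by simp
  then show ?thesis using assms(3) unfolding down_prob_def s by (simp flip: sum_divide_distrib)
qed

section \<open>Weights under the addition of one box\<close>

lemma Gamma_real_plus1: "(x::real) > 0 \<Longrightarrow> Gamma (x + 1) = x * Gamma x"
  using Gamma_plus1[of x] nonpos_Ints_nonpos[of x] by force

lemma pair_weight_step:
  assumes "\<theta> > 0" "d \<ge> \<theta>"
  shows "pair_weight \<theta> (d + 1) = pair_weight \<theta> d * ((d + 1) * (d + \<theta>) / (d * (d + 1 - \<theta>)))"
proof -
  have "Gamma (d + 1 + \<theta>) = (d + \<theta>) * Gamma (d + \<theta>)"
    "Gamma (d + 1 - \<theta> + 1) = (d + 1 - \<theta>) * Gamma (d - \<theta> + 1)"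
    using Gamma_real_plus1[of "d + \<theta>"] Gamma_real_plus1[of "d + 1 - \<theta>"] assms
    by (simp_all add: algebra_simps)
  then show ?thesis unfolding pair_weight_def using assms by (simp only: times_divide_times_eq)
      (simp add: mult_ac)
qed

lemma pair_weight_pos: "\<theta> > 0 \<Longrightarrow> d \<ge> \<theta> \<Longrightarrow> pair_weight \<theta> d > 0"
  by (simp add: pair_weight_def Gamma_real_pos)

lemma row_weight_pos: "\<theta> > 0 \<Longrightarrow> x \<ge> 0 \<Longrightarrow> row_weight \<theta> x > 0"
  by (simp add: row_weight_def Gamma_real_pos)

lemma row_weight_step:
  assumes "\<theta> > 0" "x \<ge> 0"
  shows "row_weight \<theta> (x + 1) = row_weight \<theta> x / ((x + 1) * (x + \<theta>))"
  using Gamma_real_plus1[of "x + 1"] Gamma_real_plus1[of "x + \<theta>"] assms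
  by (simp add: row_weight_def algebra_simps)

lemma jack_plancherel_nonneg:
  assumes "a \<in> bounded_partitions k n" "\<theta> > 0"
  shows "jack_plancherel k \<theta> a \<ge> 0"
  unfolding jack_plancherel_def Let_def
  using assms
  by (intro mult_nonneg_nonneg prod_nonneg ballI less_imp_le[OF pair_weight_pos]
      less_imp_le[OF row_weight_pos] row_coord_diff_ge row_coord_nonneg) auto

lemma new_row_prob_nonneg:
  assumes "\<theta> > 0"
  shows "new_row_prob k \<theta> a \<ge> 0"
  unfolding new_row_prob_def
  using row_coord_nonneg[of \<theta> _ k a] assms by (intro prod_nonneg ballI divide_nonneg_nonneg) auto

text \<open>Isolates the factors that involve row r, the only ones that change when a box is added
  there.\<close>

lemma prod_pairs_split:
  fixes f :: "nat \<Rightarrow> nat \<Rightarrow> 'a :: comm_monoid_mult"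
  assumes "r \<in> {1..k}"
  shows "(\<Prod>i=1..k. \<Prod>j=i+1..k. f i j)
    = (\<Prod>j\<in>{1..k}-{r}. if r < j then f r j else f j r)
      * (\<Prod>i\<in>{1..k}-{r}. \<Prod>j\<in>{i+1..k}-{r}. f i j)"
proof -
  have 1: "(\<Prod>j=i+1..k. f i j) = (if i < r then f i r else 1) * (\<Prod>j\<in>{i+1..k}-{r}. f i j)" for i
    using assms by (auto simp: prod.remove[of _ r])
  have 2: "(\<Prod>j=r+1..k. f r j) = (\<Prod>j\<in>{1..k}-{r}. if r < j then f r j else 1)"
    by (rule prod.mono_neutral_cong_left) (use assms in auto)
  have "(\<Prod>i=1..k. \<Prod>j=i+1..k. f i j) = (\<Prod>j=r+1..k. f r j) * (\<Prod>i\<in>{1..k}-{r}. \<Prod>j=i+1..k. f i j)"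
    using assms by (simp add: prod.remove)
  also have "(\<Prod>i\<in>{1..k}-{r}. \<Prod>j=i+1..k. f i j)
      = (\<Prod>i\<in>{1..k}-{r}. if i < r then f i r else 1) * (\<Prod>i\<in>{1..k}-{r}. \<Prod>j\<in>{i+1..k}-{r}. f i j)"
    unfolding 1 prod.distrib ..
  finally show ?thesis unfolding 2 mult.assoc[symmetric] prod.distrib[symmetric]
    by (auto intro!: prod.cong arg_cong2[of _ _ _ _ "(*)"])
qed

text \<open>Detailed balance: in terms of the process, both sides are the joint probability of
  passing through a and then b. Each pair factor with row r changes by the quotient of the matching
  factors of the two \<open>deleted_ratio\<close> products.\<close>

lemma jack_plancherel_step:
  assumes a: "a \<in> bounded_partitions k n" and b: "b \<in> bounded_partitions k (Suc n)"
    and ba: "b = a(r := Suc (a r))" and r: "r \<in> {1..k}" and \<theta>: "\<theta> > 0"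
  shows "jack_plancherel k \<theta> b * down_prob k \<theta> b r = jack_plancherel k \<theta> a * up_prob k \<theta> a r"
proof -
  define x y where "x = row_coord k \<theta> a" and "y = row_coord k \<theta> b"
  have yr: "y r = x r + 1" and yj: "j \<noteq> r \<Longrightarrow> y j = x j" for j
    by (simp_all add: x_def y_def row_coord_def ba)
  have sums: "(\<Sum>i=1..k. a i) = n" "(\<Sum>i=1..k. b i) = Suc n"
    using a b by (simp_all add: bounded_partitions_def)
  have xr: "x r \<ge> 0" using row_coord_nonneg r \<theta> by (simp add: x_def)
  define R where "R = (\<Prod>i\<in>{1..k}-{r}. row_weight \<theta> (x i))"
  define Q where "Q = (\<Prod>i\<in>{1..k}-{r}. \<Prod>j\<in>{i+1..k}-{r}. pair_weight \<theta> (x i - x j))"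
  define g where "g z j = (if r < j then pair_weight \<theta> (z r - z j) else pair_weight \<theta> (z j - z r))"
    for z :: "nat \<Rightarrow> real" and j
  have ja: "jack_plancherel k \<theta> a
      = fact n * \<theta> ^ n * (row_weight \<theta> (x r) * R) * ((\<Prod>j\<in>{1..k}-{r}. g x j) * Q)"
    unfolding jack_plancherel_def Let_def sums x_def[symmetric] prod_pairs_split[OF r] R_def Q_def g_def
    using r by (simp add: prod.remove[of _ r])
  have RQ: "R = (\<Prod>i\<in>{1..k}-{r}. row_weight \<theta> (y i))"
    "Q = (\<Prod>i\<in>{1..k}-{r}. \<Prod>j\<in>{i+1..k}-{r}. pair_weight \<theta> (y i - y j))"
    unfolding R_def Q_def by (auto intro!: prod.cong simp: yj)
  have jb: "jack_plancherel k \<theta> b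
      = fact (Suc n) * \<theta> ^ Suc n * (row_weight \<theta> (x r + 1) * R) * ((\<Prod>j\<in>{1..k}-{r}. g y j) * Q)"
    unfolding jack_plancherel_def Let_def sums y_def[symmetric] prod_pairs_split[OF r] RQ g_def
    using r by (simp add: prod.remove[of _ r] yr)
  have "g y j * ((y r - y j - \<theta>) / (y r - y j)) = g x j * ((x r - x j - (- \<theta>)) / (x r - x j))"
    if j: "j \<in> {1..k} - {r}" for j
  proof (cases "r < j")
    case True
    have d: "x r - x j \<ge> \<theta>" using row_coord_diff_ge[OF a \<theta>, of r j] True r j by (simp add: x_def)
    define d where "d = x r - x j"
    have y: "y r - y j = d + 1" using j by (simp add: d_def yr yj)
    have "pair_weight \<theta> (d + 1) * ((d + 1 - \<theta>) / (d + 1)) = pair_weight \<theta> d * ((d + \<theta>) / d)"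
      using d \<theta> by (subst pair_weight_step) (auto simp: d_def[symmetric])
    then show ?thesis using True by (simp add: g_def y d_def[symmetric])
  next
    case False
    then have lt: "j < r" using j by auto
    \<comment> \<open>For j < r the difference shrinks by 1, so the step is read from b to a. The
      gap bound for b supplies \<open>d \<ge> \<theta>\<close>; that for a would only give
      \<open>d + 1 \<ge> \<theta>\<close>.\<close>
    define d where "d = y j - y r"
    have d: "d \<ge> \<theta>" using row_coord_diff_ge[OF b \<theta>, of j r] lt r j by (simp add: y_def d_def)
    have x: "x j - x r = d + 1" "x r - x j = - (d + 1)" "y r - y j = - d"
      using j by (simp_all add: d_def yr yj)
    have "pair_weight \<theta> d * ((d + \<theta>) / d) = pair_weight \<theta> (d + 1) * ((d + 1 - \<theta>) / (d + 1))"
      using d \<theta> by (subst pair_weight_step) auto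
    moreover have "(- d - \<theta>) / (- d) = (d + \<theta>) / d"
      "(- (d + 1) - (- \<theta>)) / (- (d + 1)) = (d + 1 - \<theta>) / (d + 1)"
      using d \<theta> by (simp_all add: divide_simps) (simp_all add: algebra_simps)
    ultimately show ?thesis using False unfolding g_def x d_def[symmetric] by simp
  qed
  then have pq: "(\<Prod>j\<in>{1..k}-{r}. g y j) * deleted_ratio y \<theta> {1..k} r
      = (\<Prod>j\<in>{1..k}-{r}. g x j) * deleted_ratio x (- \<theta>) {1..k} r"
    unfolding deleted_ratio_def prod.distrib[symmetric] by (intro prod.cong) auto
  have "jack_plancherel k \<theta> b * down_prob k \<theta> b r
      = fact (Suc n) * \<theta> ^ Suc n * (row_weight \<theta> (x r + 1) * R) * Q * ((x r + 1) / real (Suc n))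
        * ((\<Prod>j\<in>{1..k}-{r}. g y j) * deleted_ratio y \<theta> {1..k} r)"
    unfolding jb down_prob_def sums y_def[symmetric] yr by simp
  \<comment> \<open>\<open>Suc n\<close> from the factorial cancels the size in
    \<open>down_prob\<close>, and \<open>x r + 1\<close> cancels in the row weight; \<theta> / (x r
    + \<theta>) is left.\<close>
  also have "\<dots> = fact n * \<theta> ^ n * (row_weight \<theta> (x r) * R) * Q * (\<theta> / (x r + \<theta>))
        * ((\<Prod>j\<in>{1..k}-{r}. g x j) * deleted_ratio x (- \<theta>) {1..k} r)"
    unfolding pq row_weight_step[OF \<theta> xr] using xr \<theta> by (simp add: divide_simps)
  also have "\<dots> = jack_plancherel k \<theta> a * up_prob k \<theta> a r"
    unfolding ja up_prob_def x_def[symmetric] by simp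
  finally show ?thesis .
qed

text \<open>A box cannot be added to row i only when row i - 1 has the same length; their
  coordinates then differ by exactly \<theta>, and a numerator of \<open>deleted_ratio\<close> is
  0.\<close>

lemma up_prob_eq_0:
  assumes a: "a \<in> bounded_partitions k n" and i: "i \<in> {1..k}"
    and notin: "a(i := Suc (a i)) \<notin> bounded_partitions k (Suc n)"
  shows "up_prob k \<theta> a i = 0"
proof -
  have mono: "a q \<le> a p" if "p \<in> {1..k}" "q \<in> {1..k}" "p \<le> q" for p q
    using a that by (auto simp: bounded_partitions_def)
  have s: "(\<Sum>j=1..k. (a(i := Suc (a i))) j) = Suc n"
    using a i by (simp add: bounded_partitions_def sum.remove[of _ i])
  have "i > 1 \<and> a (i - 1) = a i"
  proof (rule ccontr)
    assume ne: "\<not> (i > 1 \<and> a (i - 1) = a i)"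
    have "(a(i := Suc (a i))) q \<le> (a(i := Suc (a i))) p"
      if pq: "p \<in> {1..k}" "q \<in> {1..k}" "p \<le> q" for p q
    proof (cases "q = i \<and> p \<noteq> i")
      case True
      then have "p \<le> i - 1" "i - 1 \<in> {1..k}" "i > 1" using pq by auto
      then have "a (i - 1) \<le> a p" "a i \<le> a (i - 1)" "a (i - 1) \<noteq> a i"
        using mono[of p "i - 1"] mono[of "i - 1" i] pq i ne by auto
      then show ?thesis using True by auto
    next
      case False
      then show ?thesis using mono[OF pq] by (auto intro: le_SucI)
    qed
    moreover have "\<forall>j. j \<notin> {1..k} \<longrightarrow> (a(i := Suc (a i))) j = 0"
      using a i by (auto simp: bounded_partitions_def)
    ultimately have "a(i := Suc (a i)) \<in> bounded_partitions k (Suc n)"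
      using s unfolding bounded_partitions_def by blast
    with notin show False by contradiction
  qed
  then have "row_coord k \<theta> a i - row_coord k \<theta> a (i - 1) - (- \<theta>) = 0" "i - 1 \<in> {1..k} - {i}"
    using i by (auto simp: row_coord_diff of_nat_diff)
  then show ?thesis unfolding up_prob_def deleted_ratio_def
    by (auto intro!: prod_zero bexI[of _ "i - 1"])
qed

text \<open>A box cannot be removed only if row i + 1 is equally long, which makes a numerator 0, or
  if i = k is an empty row, whose coordinate 0 is a factor.\<close>

lemma down_prob_eq_0:
  assumes b: "b \<in> bounded_partitions k (Suc n)" and i: "i \<in> {1..k}"
    and notin: "\<not> (b i > 0 \<and> b(i := b i - 1) \<in> bounded_partitions k n)"
  shows "down_prob k \<theta> b i = 0"
proof -
  have mono: "b q \<le> b p" if "p \<in> {1..k}" "q \<in> {1..k}" "p \<le> q" for p q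
    using b that by (auto simp: bounded_partitions_def)
  have "i = k \<and> b k = 0 \<or> i < k \<and> b (i + 1) = b i"
  proof (rule ccontr)
    assume "\<not> ?thesis"
    then have ne: "i = k \<Longrightarrow> b k > 0" "i < k \<Longrightarrow> b (i + 1) \<noteq> b i" by auto
    have less: "i < k \<Longrightarrow> b (i + 1) < b i" using ne mono[of i "i + 1"] i by force
    have pos: "b i > 0" using less ne i by (cases "i = k") auto
    have s: "(\<Sum>j=1..k. (b(i := b i - 1)) j) = n"
      using b i pos by (simp add: bounded_partitions_def sum.remove[of _ i])
    have "(b(i := b i - 1)) q \<le> (b(i := b i - 1)) p"
      if pq: "p \<in> {1..k}" "q \<in> {1..k}" "p \<le> q" for p q
    proof (cases "p = i \<and> q \<noteq> i")
      case True
      then have "b q \<le> b (i + 1)" "b (i + 1) < b i"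
        using mono[of "i + 1" q] less pq i by auto
      then show ?thesis using True by auto
    next
      case False
      then show ?thesis using mono[OF pq] by (auto intro: le_diff_conv)
    qed
    moreover have "\<forall>j. j \<notin> {1..k} \<longrightarrow> (b(i := b i - 1)) j = 0"
      using b i by (auto simp: bounded_partitions_def)
    ultimately have "b(i := b i - 1) \<in> bounded_partitions k n"
      using s unfolding bounded_partitions_def by blast
    with notin pos show False by blast
  qed
  then show ?thesis
  proof
    assume "i = k \<and> b k = 0"
    then show ?thesis by (simp add: down_prob_def row_coord_def)
  next
    assume *: "i < k \<and> b (i + 1) = b i"
    then have "row_coord k \<theta> b i - row_coord k \<theta> b (i + 1) - \<theta> = 0" "i + 1 \<in> {1..k} - {i}"
      by (auto simp: row_coord_diff)
    then have "deleted_ratio (row_coord k \<theta> b) \<theta> {1..k} i = 0" unfolding deleted_ratio_def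
      by (intro prod_zero bexI[of _ "i + 1"]) auto
    then show ?thesis by (simp add: down_prob_def)
  qed
qed

section \<open>The mass of the shapes with at most k rows and its loss per step\<close>

definition bounded_mass :: "nat \<Rightarrow> real \<Rightarrow> nat \<Rightarrow> real" where
  "bounded_mass k \<theta> n = (\<Sum>a\<in>bounded_partitions k n. jack_plancherel k \<theta> a)"

text \<open>Insert the down probabilities, which sum to 1, turn each edge from b down to a into the
  edge from a up to b by detailed balance, and sum the up probabilities.\<close>

lemma bounded_mass_Suc:
  assumes \<theta>: "\<theta> > 0"
  shows "bounded_mass k \<theta> (Suc n)
    = (\<Sum>a\<in>bounded_partitions k n. jack_plancherel k \<theta> a * (1 - new_row_prob k \<theta> a))"
proof -
  let ?A = "bounded_partitions k n" and ?B = "bounded_partitions k (Suc n)"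
  let ?M = "jack_plancherel k \<theta>"
  let ?U = "{(a, i). a \<in> ?A \<and> i \<in> {1..k} \<and> a(i := Suc (a i)) \<in> ?B}"
  let ?D = "{(b, i). b \<in> ?B \<and> i \<in> {1..k} \<and> b i > 0 \<and> b(i := b i - 1) \<in> ?A}"
  have fin: "finite (?A \<times> {1..k})" "finite (?B \<times> {1..k})"
    by (simp_all add: finite_bounded_partitions)
  have "bounded_mass k \<theta> (Suc n) = (\<Sum>b\<in>?B. ?M b * (\<Sum>i=1..k. down_prob k \<theta> b i))"
    unfolding bounded_mass_def using sum_down_prob[OF _ \<theta>] by (intro sum.cong) auto
  also have "\<dots> = (\<Sum>(b, i)\<in>?B \<times> {1..k}. ?M b * down_prob k \<theta> b i)"
    unfolding sum_distrib_left sum.cartesian_product ..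
  \<comment> \<open>Illegal moves have probability 0, so the sums over all rows and over actual
    edges agree; on edges, adding and removing a box are inverse bijections.\<close>
  also have "\<dots> = (\<Sum>(b, i)\<in>?D. ?M b * down_prob k \<theta> b i)"
    by (rule sum.mono_neutral_right[OF fin(2)]) (auto dest: down_prob_eq_0)
  also have "\<dots> = (\<Sum>(a, i)\<in>?U. ?M a * up_prob k \<theta> a i)"
    by (rule sum.reindex_bij_witness[where i = "\<lambda>(a, i). (a(i := Suc (a i)), i)"
          and j = "\<lambda>(b, i). (b(i := b i - 1), i)"])
      (auto simp: jack_plancherel_step[OF _ _ _ _ \<theta>])
  also have "\<dots> = (\<Sum>(a, i)\<in>?A \<times> {1..k}. ?M a * up_prob k \<theta> a i)"
    by (rule sum.mono_neutral_left[OF fin(1)]) (auto dest: up_prob_eq_0)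
  also have "\<dots> = (\<Sum>a\<in>?A. ?M a * (\<Sum>i=1..k. up_prob k \<theta> a i))"
    unfolding sum_distrib_left sum.cartesian_product ..
  also have "\<dots> = (\<Sum>a\<in>?A. ?M a * (1 - new_row_prob k \<theta> a))"
    using sum_up_prob[OF _ \<theta>] by (intro sum.cong) auto
  finally show ?thesis .
qed

lemma new_row_prob_eq_0: "k \<ge> 1 \<Longrightarrow> a k = 0 \<Longrightarrow> new_row_prob k \<theta> a = 0"
  unfolding new_row_prob_def by (rule prod_zero) (auto intro!: bexI[of _ k] simp: row_coord_def)

text \<open>Only shapes with k nonempty rows lose mass, because row k + 1 cannot open while row k is
  empty.\<close>

lemma bounded_mass_diff:
  assumes "\<theta> > 0" "k \<ge> 1"
  shows "bounded_mass k \<theta> n - bounded_mass k \<theta> (Suc n)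
    = (\<Sum>a | a \<in> bounded_partitions k n \<and> a k \<ge> 1. jack_plancherel k \<theta> a * new_row_prob k \<theta> a)"
proof -
  have "bounded_mass k \<theta> n - bounded_mass k \<theta> (Suc n)
      = (\<Sum>a\<in>bounded_partitions k n. jack_plancherel k \<theta> a * new_row_prob k \<theta> a)"
    unfolding bounded_mass_Suc[OF assms(1)] unfolding bounded_mass_def
    by (simp add: right_diff_distrib flip: sum_subtractf)
  also have "\<dots> = (\<Sum>a | a \<in> bounded_partitions k n \<and> a k \<ge> 1.
      jack_plancherel k \<theta> a * new_row_prob k \<theta> a)"
    using new_row_prob_eq_0[OF assms(2)]
    by (intro sum.mono_neutral_right[OF finite_bounded_partitions]) (auto simp: Suc_le_eq)
  finally show ?thesis .
qed

section \<open>Changing the number of rows, and decay of the mass\<close>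

lemma bounded_partitions_eq_Suc:
  "bounded_partitions k n = {a \<in> bounded_partitions (Suc k) n. a (Suc k) = 0}"
proof (intro set_eqI iffI)
  fix a assume "a \<in> bounded_partitions k n"
  then show "a \<in> {a \<in> bounded_partitions (Suc k) n. a (Suc k) = 0}"
    by (auto simp: bounded_partitions_def le_Suc_eq)
next
  fix a assume "a \<in> {a \<in> bounded_partitions (Suc k) n. a (Suc k) = 0}"
  then show "a \<in> bounded_partitions k n"
    by (auto simp: bounded_partitions_def) (metis le_SucE)
qed

text \<open>An extra empty row moves every other coordinate up by \<theta> and sits at 0 with row
  weight 1; its pair weights turn \<open>row_weight \<theta> (x + \<theta>)\<close> back into
  \<open>row_weight \<theta> x\<close>.\<close>

lemma jack_plancherel_Suc:
  assumes "a (Suc k) = 0" and \<theta>: "\<theta> > 0"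
  shows "jack_plancherel (Suc k) \<theta> a = jack_plancherel k \<theta> a"
proof -
  define x where "x = row_coord k \<theta> a"
  define y where "y = row_coord (Suc k) \<theta> a"
  have yS: "y (Suc k) = 0"
    using assms by (simp add: row_coord_def y_def)
  have y: "y i = x i + \<theta>" if "i \<in> {1..k}" for i
    by (simp add: row_coord_def x_def y_def algebra_simps)
  have w0: "row_weight \<theta> 0 = 1"
    using Gamma_real_pos[OF \<theta>] by (simp add: row_weight_def)
  have w: "row_weight \<theta> (x i + \<theta>) * pair_weight \<theta> (x i + \<theta>) = row_weight \<theta> (x i)"
    if "i \<in> {1..k}" for i
  proof -
    have "x i \<ge> 0" using row_coord_nonneg[OF \<theta> that] by (simp add: x_def)
    then have pos: "x i + \<theta> > 0" "x i + \<theta> + \<theta> > 0" using \<theta> by auto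
    show ?thesis
      unfolding row_weight_def pair_weight_def Gamma_real_plus1[OF pos(1)]
      using less_imp_neq[OF Gamma_real_pos[OF pos(2)]] pos by simp
  qed
  have p: "(\<Prod>j=i+1..Suc k. f i j) = (\<Prod>j=i+1..k. f i j) * f i (Suc k)"
    if "i \<in> {1..k}" for i and f :: "nat \<Rightarrow> nat \<Rightarrow> real"
    using that by (simp add: prod.nat_ivl_Suc')
  have "(\<Prod>i=1..Suc k. row_weight \<theta> (y i)) *
      (\<Prod>i=1..Suc k. \<Prod>j=i+1..Suc k. pair_weight \<theta> (y i - y j))
    = (\<Prod>i=1..k. row_weight \<theta> (y i)) * (\<Prod>i=1..k. \<Prod>j=i+1..Suc k. pair_weight \<theta> (y i - y j))"
    by (simp add: yS w0)
  also have "(\<Prod>i=1..k. row_weight \<theta> (y i)) = (\<Prod>i=1..k. row_weight \<theta> (x i + \<theta>))"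
    using y by (intro prod.cong) auto
  also have "(\<Prod>i=1..k. \<Prod>j=i+1..Suc k. pair_weight \<theta> (y i - y j))
      = (\<Prod>i=1..k. (\<Prod>j=i+1..k. pair_weight \<theta> (x i - x j)) * pair_weight \<theta> (x i + \<theta>))"
    using y by (intro prod.cong refl) (simp only: p, auto simp: yS intro!: arg_cong2[of _ _ _ _ "(*)"] prod.cong)
  also have "(\<Prod>i=1..k. row_weight \<theta> (x i + \<theta>)) *
      (\<Prod>i=1..k. (\<Prod>j=i+1..k. pair_weight \<theta> (x i - x j)) * pair_weight \<theta> (x i + \<theta>))
      = (\<Prod>i=1..k. (row_weight \<theta> (x i + \<theta>) * pair_weight \<theta> (x i + \<theta>))) *
      (\<Prod>i=1..k. \<Prod>j=i+1..k. pair_weight \<theta> (x i - x j))"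
    unfolding prod.distrib by simp
  also have "(\<Prod>i=1..k. (row_weight \<theta> (x i + \<theta>) * pair_weight \<theta> (x i + \<theta>)))
      = (\<Prod>i=1..k. row_weight \<theta> (x i))"
    by (rule prod.cong[OF refl w])
  finally show ?thesis
    using assms unfolding jack_plancherel_def Let_def x_def[symmetric] y_def[symmetric]
    by (simp only: mult.assoc) simp
qed

lemma bounded_mass_eq_sum_Suc:
  assumes "\<theta> > 0"
  shows "bounded_mass k \<theta> n
    = (\<Sum>a | a \<in> bounded_partitions (Suc k) n \<and> a (Suc k) = 0. jack_plancherel (Suc k) \<theta> a)"
  unfolding bounded_mass_def bounded_partitions_eq_Suc[of k]
  using jack_plancherel_Suc[OF _ assms] by (intro sum.cong) auto

lemma bounded_mass_0: "\<theta> > 0 \<Longrightarrow> bounded_mass k \<theta> 0 = 1"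
proof (induction k)
  case 0
  have "bounded_partitions 0 0 = {\<lambda>_. 0}" by (auto simp: bounded_partitions_def)
  then show ?case by (simp add: bounded_mass_def jack_plancherel_def)
next
  case (Suc k)
  have "{a \<in> bounded_partitions (Suc k) 0. a (Suc k) = 0} = bounded_partitions (Suc k) 0"
    by (auto simp: bounded_partitions_def)
  then show ?case using Suc bounded_mass_eq_sum_Suc[of \<theta> k 0] by (simp add: bounded_mass_def)
qed

lemma bounded_mass_nonneg: "\<theta> > 0 \<Longrightarrow> bounded_mass k \<theta> n \<ge> 0"
  unfolding bounded_mass_def by (intro sum_nonneg jack_plancherel_nonneg)

text \<open>All rows have length at least 1, so x i \<ge> 1, and x / (x + \<theta>) increases with
  x.\<close>

lemma new_row_prob_ge:
  assumes a: "a \<in> bounded_partitions k n" and "a k \<ge> 1" "\<theta> > 0"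
  shows "new_row_prob k \<theta> a \<ge> (1 / (1 + \<theta>)) ^ k"
proof -
  have "(\<Prod>i=1..k. 1 / (1 + \<theta>)) \<le> new_row_prob k \<theta> a"
    unfolding new_row_prob_def
  proof (intro prod_mono conjI)
    fix i assume i: "i \<in> {1..k}"
    then have "a k \<le> a i" using a by (auto simp: bounded_partitions_def)
    then have "1 \<le> real (a i)" "(real k - real i) * \<theta> \<ge> 0" using assms i by auto
    then have x: "1 \<le> row_coord k \<theta> a i" unfolding row_coord_def by linarith
    then have "\<theta> * 1 \<le> \<theta> * row_coord k \<theta> a i"
      using assms by (intro mult_left_mono) auto
    then have "1 * (row_coord k \<theta> a i + \<theta>) \<le> row_coord k \<theta> a i * (1 + \<theta>)"
      by (simp add: algebra_simps)
    then show "1 / (1 + \<theta>) \<le> row_coord k \<theta> a i / (row_coord k \<theta> a i + \<theta>)"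
      using assms x by (subst frac_le_eq) (auto simp: divide_le_0_iff)
  qed (use assms in auto)
  then show ?thesis by simp
qed

lemma bounded_mass_tendsto_0:
  assumes \<theta>: "\<theta> > 0"
  shows "bounded_mass k \<theta> \<longlonglongrightarrow> 0"
proof (induction k)
  case 0
  have "bounded_partitions 0 n = {}" if "n > 0" for n
    using that by (auto simp: bounded_partitions_def)
  then have "eventually (\<lambda>n. bounded_mass 0 \<theta> n = 0) sequentially"
    by (auto simp: bounded_mass_def eventually_at_top_linorder intro!: exI[of _ 1])
  then show ?case by (rule tendsto_eventually)
next
  case (Suc k)
  let ?P = "bounded_mass (Suc k) \<theta>" and ?M = "jack_plancherel (Suc k) \<theta>"
  let ?A = "bounded_partitions (Suc k)"
  let ?c = "(1 / (1 + \<theta>)) ^ Suc k"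
  \<comment> \<open>\<open>?P n - bounded_mass k \<theta> n\<close> is the mass of the shapes with
    exactly \<open>Suc k\<close> nonempty rows, each of which loses at least the fraction
    \<open>?c\<close>.\<close>
  have drop: "?c * (?P n - bounded_mass k \<theta> n) \<le> ?P n - ?P (Suc n)" for n
  proof -
    have "?P n = (\<Sum>a\<in>{a\<in>?A n. a (Suc k) = 0} \<union> {a\<in>?A n. a (Suc k) \<ge> 1}. ?M a)"
      unfolding bounded_mass_def by (rule sum.cong) auto
    also have "\<dots> = bounded_mass k \<theta> n + (\<Sum>a | a \<in> ?A n \<and> a (Suc k) \<ge> 1. ?M a)"
      unfolding bounded_mass_eq_sum_Suc[OF \<theta>]
      by (rule sum.union_disjoint) (auto simp: finite_bounded_partitions)
    finally have "?c * (?P n - bounded_mass k \<theta> n)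
        = (\<Sum>a | a \<in> ?A n \<and> a (Suc k) \<ge> 1. ?M a * ?c)"
      by (simp add: sum_distrib_left mult.commute)
    also have "\<dots> \<le> (\<Sum>a | a \<in> ?A n \<and> a (Suc k) \<ge> 1. ?M a * new_row_prob (Suc k) \<theta> a)"
      using \<theta> by (intro sum_mono mult_left_mono new_row_prob_ge jack_plancherel_nonneg) auto
    also have "\<dots> = ?P n - ?P (Suc n)" using bounded_mass_diff[OF \<theta>, of "Suc k" n] by simp
    finally show ?thesis .
  qed
  have "?P n - ?P (Suc n) \<ge> 0" for n
    using bounded_mass_diff[OF \<theta>, of "Suc k" n] \<theta>
    by (auto intro!: sum_nonneg mult_nonneg_nonneg jack_plancherel_nonneg new_row_prob_nonneg)
  then have "decseq ?P" by (intro decseq_SucI) (simp add: algebra_simps)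
  then obtain L where L: "?P \<longlonglongrightarrow> L"
    using decseq_convergent[of ?P 0] bounded_mass_nonneg[OF \<theta>] by blast
  have "L \<ge> 0" using L bounded_mass_nonneg[OF \<theta>] by (intro LIMSEQ_le_const) auto
  have "(\<lambda>n. ?c * (?P n - bounded_mass k \<theta> n)) \<longlonglongrightarrow> ?c * (L - 0)"
    by (intro tendsto_intros L Suc)
  moreover have "(\<lambda>n. ?P n - ?P (Suc n)) \<longlonglongrightarrow> L - L"
    by (intro tendsto_intros L LIMSEQ_Suc)
  \<comment> \<open>In the limit the loss vanishes, and by induction the shapes with at most k rows
    carry no mass.\<close>
  ultimately have "?c * (L - 0) \<le> L - L"
    using drop by (intro LIMSEQ_le) auto
  moreover have "?c > 0" using \<theta> by simp
  ultimately have "L \<le> 0" using mult_pos_pos[of ?c L] by (auto simp: not_less[symmetric])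
  with \<open>L \<ge> 0\<close> L show ?case by simp
qed

section \<open>The summand as weight times new-row probability\<close>

lemma pochhammer_Gamma_real: "(x::real) > 0 \<Longrightarrow> pochhammer x n = Gamma (x + real n) / Gamma x"
  using pochhammer_Gamma[of x n] nonpos_Ints_nonpos[of x] by force

text \<open>With A (i + 1) supplied by the factorial, the shifted product runs over i + 1, ..., k +
  2; its last two factors are those governed by the convention for the entries k + 1 and k +
  2.\<close>

lemma prod_shift_two:
  fixes A :: "nat \<Rightarrow> 'a :: comm_monoid_mult"
  assumes "i \<le> k"
  shows "A (i + 1) * (\<Prod>j=i+1..k+1. A (j + 1)) = A (k + 1) * A (k + 2) * (\<Prod>j=i+1..k. A j)"
proof -
  have "(\<Prod>j=i+1..k+1. A (j + 1)) = (\<Prod>j=Suc (i+1)..k+2. A j)"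
    using prod.shift_bounds_cl_Suc_ivl[of A "i + 1" "k + 1"] by simp
  then have "A (i + 1) * (\<Prod>j=i+1..k+1. A (j + 1)) = (\<Prod>j=i+1..k+2. A j)"
    using assms by (subst prod.atLeast_Suc_atMost[of "i + 1"]) simp_all
  also have "\<dots> = A (k + 1) * A (k + 2) * (\<Prod>j=i+1..k. A j)"
    using assms by (simp add: prod.nat_ivl_Suc' mult_ac)
  finally show ?thesis .
qed

lemma prod_shift_down:
  fixes B :: "nat \<Rightarrow> 'a :: comm_monoid_mult"
  assumes "i \<le> k"
  shows "(\<Prod>j=i+1..k+1. B (j - 1)) = B i * (\<Prod>j=i+1..k. B j)"
  using assms prod.shift_bounds_cl_Suc_ivl[of "\<lambda>j. B (j - 1)" i k]
  by (simp add: prod.atLeast_Suc_atMost[of i])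

text \<open>For fixed i, each Pochhammer symbol is a quotient of Gamma values whose numerator
  depends on j + 1 and whose denominator on j - 1. Shifting both to index j produces the pair
  weights, and the boundary factors give the row weight and the new-row factor.\<close>

lemma tuple_summand_row:
  assumes a: "a \<in> bounded_partitions k n" and ak: "a k \<ge> 1" and \<theta>: "\<theta> > 0" and i: "i \<in> {1..k}"
  defines "b \<equiv> extend_tuple k a" and "x \<equiv> row_coord k \<theta> a"
  shows "(\<Prod>j=i+1..k. (real j - real i) * \<theta> + real (b i) - real (b j)) /
     (fact (b i - b (i + 1)) * (\<Prod>j=i+1..k+1.
        pochhammer ((real j - real i) * \<theta> + real (b i) - real (b (j - 1)))
                         (b (j - 1) - b (j + 1) + 1)))
    = row_weight \<theta> (x i) * (\<Prod>j=i+1..k. pair_weight \<theta> (x i - x j)) * (x i / (x i + \<theta>))"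
proof -
  define A where "A m = Gamma ((real m - 1 - real i) * \<theta> + real (b i) - real (b m) + 1)" for m
  define B where "B m = Gamma ((real m + 1 - real i) * \<theta> + real (b i) - real (b m))" for m
  have mono: "b q \<le> b p" if "1 \<le> p" "p \<le> q" for p q
  proof -
    have anti: "a q \<le> a p" if "1 \<le> p" "p \<le> q" "q \<le> k" for p q
      using a that by (auto simp: bounded_partitions_def)
    show ?thesis
    proof (cases "p \<le> k")
      case True
      then have "a p \<ge> 1" using anti[of p k] that ak by simp
      then show ?thesis using anti[of p q] that True by (simp add: b_def extend_tuple_def)
    next
      case False
      then show ?thesis using that by (simp add: b_def extend_tuple_def)
    qed
  qed
  have bi: "b j = a j" if "j \<le> k" for j using that by (simp add: b_def extend_tuple_def)
  have bk: "b (k + 1) = 1" "b (k + 2) = 0" by (simp_all add: b_def extend_tuple_def)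
  have d: "(real j - real i) * \<theta> + real (b i) - real (b j) = x i - x j" if "j \<in> {i..k}" for j
    using that i unfolding x_def row_coord_diff by (simp add: bi)
  have dpos: "x i - x j \<ge> \<theta>" if "j \<in> {i+1..k}" for j
    using row_coord_diff_ge[OF a \<theta>, of i j] that i by (simp add: x_def)
  have "x i \<ge> 1"
  proof -
    have "a k \<le> a i" using a i by (auto simp: bounded_partitions_def)
    then have "1 \<le> real (a i)" "(real k - real i) * \<theta> \<ge> 0" using ak \<theta> i by auto
    then show ?thesis unfolding x_def row_coord_def by linarith
  qed
  have poch: "pochhammer ((real j - real i) * \<theta> + real (b i) - real (b (j - 1)))
                         (b (j - 1) - b (j + 1) + 1) = A (j + 1) / B (j - 1)" if j: "j \<in> {i+1..k+1}" for j
  proof -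
    have "b (j - 1) \<le> b i" "b (j + 1) \<le> b (j - 1)" using mono i j by auto
    moreover have "(real j - real i) * \<theta> > 0" using j \<theta> by auto
    ultimately show ?thesis using j
      by (subst pochhammer_Gamma_real) (auto simp: A_def B_def of_nat_diff algebra_simps)
  qed
  have "fact (b i - b (i + 1)) = A (i + 1)"
    using mono[of i "i + 1"] i Gamma_fact[of "b i - b (i + 1)", where ?'a = real]
    by (simp add: A_def of_nat_diff algebra_simps)
  then have "fact (b i - b (i + 1)) * (\<Prod>j=i+1..k+1.
        pochhammer ((real j - real i) * \<theta> + real (b i) - real (b (j - 1)))
                         (b (j - 1) - b (j + 1) + 1))
     = A (i + 1) * (\<Prod>j=i+1..k+1. A (j + 1)) / (\<Prod>j=i+1..k+1. B (j - 1))"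
    using poch by (simp add: prod_dividef)
  also have "\<dots> = A (k + 1) * A (k + 2) * (\<Prod>j=i+1..k. A j) / (B i * (\<Prod>j=i+1..k. B j))"
    using i prod_shift_two[of i k A] prod_shift_down[of i k B] by simp
  \<comment> \<open>The value \<open>b (k + 1) = 1\<close> absorbs the + 1 in A. The product Gamma
    (x i) * Gamma (x i + \<theta> + 1) differs from the denominator of \<open>row_weight\<close> by
    exactly the new-row factor.\<close>
  also have "A (k + 1) = Gamma (x i)"
    unfolding A_def bk using i by (simp add: x_def row_coord_def bi algebra_simps)
  also have "A (k + 2) = Gamma (x i + \<theta> + 1)"
    unfolding A_def bk using i by (simp add: x_def row_coord_def bi algebra_simps)
  also have "B i = Gamma \<theta>" by (simp add: B_def)
  finally have den: "fact (b i - b (i + 1)) * (\<Prod>j=i+1..k+1.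
        pochhammer ((real j - real i) * \<theta> + real (b i) - real (b (j - 1)))
                         (b (j - 1) - b (j + 1) + 1))
     = Gamma (x i) * Gamma (x i + \<theta> + 1) * (\<Prod>j=i+1..k. A j) / (Gamma \<theta> * (\<Prod>j=i+1..k. B j))" .
  have pw: "(x i - x j) * B j / A j = pair_weight \<theta> (x i - x j)" if "j \<in> {i+1..k}" for j
  proof -
    have *: "j \<in> {i..k}" using that by auto
    have "A j = Gamma (x i - x j - \<theta> + 1)" "B j = Gamma (x i - x j + \<theta>)"
      unfolding A_def B_def d[OF *, symmetric] by (simp_all add: algebra_simps)
    then show ?thesis by (simp add: pair_weight_def)
  qed
  have "(\<Prod>j=i+1..k. (real j - real i) * \<theta> + real (b i) - real (b j)) = (\<Prod>j=i+1..k. x i - x j)"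
    using d by (intro prod.cong) auto
  then have "(\<Prod>j=i+1..k. (real j - real i) * \<theta> + real (b i) - real (b j)) /
     (fact (b i - b (i + 1)) * (\<Prod>j=i+1..k+1.
        pochhammer ((real j - real i) * \<theta> + real (b i) - real (b (j - 1)))
                         (b (j - 1) - b (j + 1) + 1)))
    = (\<Prod>j=i+1..k. (x i - x j) * B j / A j) * (Gamma \<theta> / (Gamma (x i) * Gamma (x i + \<theta> + 1)))"
    unfolding den by (simp add: prod_dividef prod.distrib mult_ac)
  also have "(\<Prod>j=i+1..k. (x i - x j) * B j / A j) = (\<Prod>j=i+1..k. pair_weight \<theta> (x i - x j))"
    by (rule prod.cong[OF refl pw])
  also have "Gamma \<theta> / (Gamma (x i) * Gamma (x i + \<theta> + 1)) = row_weight \<theta> (x i) * (x i / (x i + \<theta>))"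
    using Gamma_real_plus1[of "x i"] Gamma_real_plus1[of "x i + \<theta>"] \<open>x i \<ge> 1\<close> \<theta>
    by (simp add: row_weight_def)
  finally show ?thesis by (simp add: mult_ac)
qed

lemma tuple_summand_eq:
  assumes "a \<in> bounded_partitions k n" "a k \<ge> 1" "\<theta> > 0"
  shows "tuple_summand k \<theta> a = jack_plancherel k \<theta> a * new_row_prob k \<theta> a"
proof -
  note row = tuple_summand_row[OF assms]
  define s where "s = (\<Sum>i=1..k. a i)"
  have "tuple_summand k \<theta> a = fact s * \<theta> ^ s *
    (\<Prod>i=1..k. (\<Prod>j=i+1..k. (real j - real i) * \<theta> + real (extend_tuple k a i) - real (extend_tuple k a j)) /
     (fact (extend_tuple k a i - extend_tuple k a (i + 1)) * (\<Prod>j=i+1..k+1.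
        pochhammer ((real j - real i) * \<theta> + real (extend_tuple k a i) - real (extend_tuple k a (j - 1)))
                         (extend_tuple k a (j - 1) - extend_tuple k a (j + 1) + 1))))"
    unfolding tuple_summand_def Let_def s_def prod_dividef prod.distrib by simp
  also have "\<dots> = fact s * \<theta> ^ s *
    (\<Prod>i=1..k. row_weight \<theta> (row_coord k \<theta> a i) *
      (\<Prod>j=i+1..k. pair_weight \<theta> (row_coord k \<theta> a i - row_coord k \<theta> a j)) *
      (row_coord k \<theta> a i / (row_coord k \<theta> a i + \<theta>)))"
    by (intro arg_cong2[of _ _ _ _ "(*)"] refl prod.cong row)
  also have "\<dots> = jack_plancherel k \<theta> a * new_row_prob k \<theta> a"
    unfolding jack_plancherel_def new_row_prob_def Let_def s_def prod.distrib by (simp add: mult_ac)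
  finally show ?thesis .
qed

section \<open>Summation over all tuples\<close>

text \<open>Bridges the two encodings: \<open>decreasing_tuples\<close> uses extensional functions,
  \<open>bounded_partitions\<close> pads with 0.\<close>

lemma tuple_summand_cong:
  assumes "\<And>i. i \<in> {1..k} \<Longrightarrow> a i = a' i"
  shows "tuple_summand k \<theta> a = tuple_summand k \<theta> a'"
proof -
  \<comment> \<open>Index 0 is left out since \<open>extend_tuple\<close> copies \<open>a 0\<close>;
    the summand reads only indices from 1 on, as j - 1 \<ge> i.\<close>
  have "extend_tuple k a i = extend_tuple k a' i" if "i \<ge> 1" for i
    using assms that by (simp add: extend_tuple_def)
  moreover have "(\<Sum>i=1..k. a i) = (\<Sum>i=1..k. a' i)" using assms by (intro sum.cong) auto
  ultimately show ?thesis unfolding tuple_summand_def Let_def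
    by (intro arg_cong2[of _ _ _ _ "(/)"] arg_cong2[of _ _ _ _ "(*)"] prod.cong) auto
qed

theorem theorem2p4p1:
  fixes k :: nat and \<theta> :: real
  assumes "k \<ge> 1" and "\<theta> > 0"
  shows "(tuple_summand k \<theta> has_sum 1) (decreasing_tuples k)"
proof -
  define S where "S n = {a \<in> bounded_partitions k n. a k \<ge> 1}" for n
  define f where "f = (\<lambda>(n :: nat, a). jack_plancherel k \<theta> a * new_row_prob k \<theta> a)"
  let ?g = "\<lambda>n. bounded_mass k \<theta> n - bounded_mass k \<theta> (Suc n)"
  have f_nonneg: "f (n, a) \<ge> 0" if "a \<in> S n" for n a
    using that assms by (auto simp: f_def S_def intro!: mult_nonneg_nonneg
        jack_plancherel_nonneg new_row_prob_nonneg)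
  have slice: "((\<lambda>a. f (n, a)) has_sum ?g n) (S n)" for n
    unfolding bounded_mass_diff[OF assms(2,1)] f_def S_def
    by (simp add: has_sum_finite finite_bounded_partitions)
  have "?g sums (bounded_mass k \<theta> 0 - 0)"
    by (rule telescope_sums'[OF bounded_mass_tendsto_0[OF assms(2)]])
  moreover have "?g n \<ge> 0" for n
    using slice f_nonneg by (rule has_sum_nonneg)
  \<comment> \<open>Nonnegative terms turn the ordered series into an unconditional sum, ready to be
    combined with the finite sums over each size n.\<close>
  ultimately have g: "(?g has_sum 1) UNIV"
    using bounded_mass_0[OF assms(2)] by (intro sums_nonneg_imp_has_sum) auto
  have "f summable_on Sigma UNIV S"
    using slice has_sum_imp_summable[OF g] f_nonneg by (rule summable_on_SigmaI)
  with slice g have "(f has_sum 1) (Sigma UNIV S)"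
    by (rule has_sum_SigmaI)
  \<comment> \<open>Zero padding and restriction to \<open>{1..k}\<close> are inverse; the size n is
    recovered as the sum of the entries.\<close>
  moreover have "(f has_sum 1) (Sigma UNIV S) = (tuple_summand k \<theta> has_sum 1) (decreasing_tuples k)"
  proof (rule has_sum_reindex_bij_witness[where j = "\<lambda>(n, a). restrict a {1..k}"
        and i = "\<lambda>a. (\<Sum>i=1..k. a i, \<lambda>i. if i \<in> {1..k} then a i else 0)"])
    fix p assume "p \<in> Sigma UNIV S"
    then obtain n a where p: "p = (n, a)" and a: "a \<in> bounded_partitions k n" "a k \<ge> 1"
      by (auto simp: S_def)
    have supp: "a i = 0" if "i \<notin> {1..k}" for i using a that by (auto simp: bounded_partitions_def)
    have pos: "a i \<ge> 1" if "i \<in> {1..k}" for i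
    proof -
      have "a k \<le> a i" using a that by (auto simp: bounded_partitions_def)
      with a(2) show ?thesis by linarith
    qed
    show "(\<lambda>a. (\<Sum>i=1..k. a i, \<lambda>i. if i \<in> {1..k} then a i else 0))
        ((\<lambda>(n, a). restrict a {1..k}) p) = p"
      using a supp by (auto simp: p bounded_partitions_def)
    show "(\<lambda>(n, a). restrict a {1..k}) p \<in> decreasing_tuples k"
      using a pos by (auto simp: p decreasing_tuples_def bounded_partitions_def)
    have "tuple_summand k \<theta> (restrict a {1..k}) = tuple_summand k \<theta> a"
      by (rule tuple_summand_cong) simp
    then show "tuple_summand k \<theta> ((\<lambda>(n, a). restrict a {1..k}) p) = f p"
      using tuple_summand_eq[OF a assms(2)] by (simp add: p f_def)
  next
    fix a assume a: "a \<in> decreasing_tuples k"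
    then have dec: "\<forall>i\<in>{1..k}. \<forall>j\<in>{1..k}. i \<le> j \<longrightarrow> a j \<le> a i"
      and ge: "a k \<ge> 1" and ext: "a \<in> extensional {1..k}"
      using assms(1) by (auto simp: decreasing_tuples_def PiE_def)
    have "restrict (\<lambda>i. if i \<in> {1..k} then a i else 0) {1..k} = a"
      using ext by (intro extensionalityI[of _ "{1..k}"]) auto
    then show "(\<lambda>(n, a). restrict a {1..k})
        (\<Sum>i=1..k. a i, \<lambda>i. if i \<in> {1..k} then a i else 0) = a"
      by (simp only: prod.case)
    have "(\<lambda>i. if i \<in> {1..k} then a i else 0) \<in> S (\<Sum>i=1..k. a i)"
      unfolding S_def bounded_partitions_def using dec ge assms(1) by simp
    then show "(\<Sum>i=1..k. a i, \<lambda>i. if i \<in> {1..k} then a i else 0) \<in> Sigma UNIV S"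
      by blast
  qed simp
  ultimately show ?thesis by simp
qed

end
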